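(* Let $(\mathbf G,\mathbf G')$ be a dual pair of one even orthogonal group and one symplectic group in stable range, and let $\Lambda\in\mathcal S_{\mathbf G}$. Then $\underline\theta_{\mathbf G'}(\Lambda)=\overline\theta_{\mathbf G'}(\Lambda)$.
   Context: **Stable range.** $(\mathbf G,\mathbf G')$ is $(\mathrm O^\epsilon_{2n},\mathrm{Sp}_{2n'})$ with $n'\ge2n$, or $(\mathrm{Sp}_{2n},\mathrm O^+_{2n'})$ with $n'\ge2n$, or $(\mathrm{Sp}_{2n},\mathrm O^-_{2n'})$ with $n'-1\ge2n$. **Symbols.** A $\beta$-set is a finite set of non-negative integers in strictly decreasing order. A symbol is an ordered pair $\Lambda=\binom AB$ of $\beta$-sets, taken modulo the equivalence generated by $\binom{a_1,\dots,a_{m_1}}{b_1,\dots,b_{m_2}}\sim\binom{a_1+1,\dots,a_{m_1}+1,0}{b_1+1,\dots,b_{m_2}+1,0}$ (each class has a unique reduced representative, with $0\notin A\cap B$). $\mathrm{rk}(\Lambda)=\sum_{a\in A}a+\sum_{b\in B}b-\lfloor(\frac{|A|+|B|-1}{2})^2\rfloor$, $\mathrm{def}(\Lambda)=|A|-|B|$. $\mathcal S_{n,\delta}$ is the set of symbols of rank $n$ and defect $\delta$. $\mathcal S_{\mathrm{Sp}_{2n}},\mathcal S_{\mathrm O^+_{2n}},\mathcal S_{\mathrm O^-_{2n}}$ are the sets of symbols of rank $n$ and defect $\equiv1,0,2\pmod 4$ respectively (parametrizing the unipotent characters of these finite groups over $\mathbb F_q$, $q$ odd). $\Upsilon(\Lambda)=\begin{bmatrix}\lambda\\\mu\end{bmatrix}$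 is the bi-partition with $\lambda_i=a_i-(m_1-i)$, $\mu_j=b_j-(m_2-j)$; write $\Upsilon(\Lambda)^*=\lambda$, $\Upsilon(\Lambda)_*=\mu$. Partitions are considered up to trailing zeros, $\|\cdot\|$ is the sum of parts, $\cup$ is multiset union of parts. **$\Theta$.** For $\Lambda\in\mathcal S_{n,\delta}\subset\mathcal S_{\mathbf G}$ write $\delta=4d+1,4d,4d+2$ for $\mathbf G=\mathrm{Sp}_{2n},\mathrm O^+_{2n},\mathrm O^-_{2n}$ respectively. Put $\delta'=-\delta+1$, $\tau=n'-n+2d$ if $\epsilon=+$; $\delta'=-\delta-1$, $\tau=n'-n-1-2d$ if $\epsilon=-$. With $\Upsilon(\Lambda)=\begin{bmatrix}\lambda\\\mu\end{bmatrix}$, $\Theta_{\mathbf G'}(\Lambda)$ is the set of $\Lambda'\in\mathcal S_{n',\delta'}$, $\Upsilon(\Lambda')=\begin{bmatrix}\lambda'\\\mu'\end{bmatrix}$, such that for all $i$: if $\epsilon=+$, $\lambda'_{i+1}\le\mu_i\le\lambda'_i$ and $\lambda_{i+1}\le\mu'_i\le\lambda_i$; if $\epsilon=-$, $\mu'_{i+1}\le\lambda_i\le\mu'_i$ and $\mu_{i+1}\le\lambda'_i\le\mu_i$. **Order of a symbol.** $\mathrm{ord}(\Lambda)$ is the degree in $q$ of the corresponding unipotent character $\rho_\Lambda(1)$; explicitly, for $\Lambda=\binom{a_1,\dots,a_{m_1}}{b_1,\dots,b_{m_2}}\in\mathcal S_{\mathbf G}$, $m=m_1+m_2$, $$\mathrm{ord}(\Lambda)=N+\sum_i(m_1-i)a_i+\sum_j(m_2-j)b_j+\sum_{i,j}\max(a_i,b_j)-\sum_ia_i(a_i+1)-\sum_jb_j(b_j+1)-\textstyle\binom{m-2}2-\binom{m-4}2-\cdots,$$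 with $N=n(n+1)$ for $\mathrm{Sp}_{2n}$ and $N=n^2$ for $\mathrm O^\pm_{2n}$. **$\underline\theta$ and $\overline\theta$ (for $\tau\ge0$).** $\underline\theta_{\mathbf G'}(\Lambda)=\theta_0(\Lambda)$ is the symbol in $\mathcal S_{n',\delta'}$ with $\Upsilon(\theta_0(\Lambda))=\begin{bmatrix}\mu\cup[\tau]\\\lambda\end{bmatrix}$ if $\epsilon=+$, $\begin{bmatrix}\mu\\\lambda\cup[\tau]\end{bmatrix}$ if $\epsilon=-$. Linear order on $\mathcal S_{n,\delta}$ (and likewise on $\mathcal S_{n',\delta'}$): for $\epsilon=+$, compare first $\|\Upsilon(\cdot)^*\|$, then $\Upsilon(\cdot)^*$ lexicographically, then $\Upsilon(\cdot)_*$ lexicographically; for $\epsilon=-$, compare first $\|\Upsilon(\cdot)_*\|$, then $\Upsilon(\cdot)_*$ lexicographically, then $\Upsilon(\cdot)^*$ lexicographically. Inductively, $\overline\theta_{\mathbf G'}(\Lambda)$ is the smallest element in the set of elements of maximal order $\mathrm{ord}$ in $\Theta^\flat_{\mathbf G'}(\Lambda)=\Theta_{\mathbf G'}(\Lambda)\smallsetminus\{\overline\theta_{\mathbf G'}(\Lambda_1):\Lambda_1\in\mathcal S_{n,\delta},\Lambda_1<\Lambda\}$ (a non-empty set). *)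

theory Defs
  imports Complex_Main "HOL-Library.Multiset_Order"
begin

section \<open>Symbols\<close>

text \<open>
  A beta-set is a finite set of naturals. If its elements are listed in decreasing order
  \<open>a\<^sub>1 > \<dots> > a\<^sub>m\<close>, then \<open>below A a\<^sub>i = m - i\<close>.
\<close>

definition below :: "nat set \<Rightarrow> nat \<Rightarrow> nat" where
  "below A a = card {x \<in> A. x < a}"

definition shift_set :: "nat set \<Rightarrow> nat set" where
  "shift_set A = insert 0 (Suc ` A)"

definition shift_pair :: "nat set \<times> nat set \<Rightarrow> nat set \<times> nat set" where
  "shift_pair P = (shift_set (fst P), shift_set (snd P))"

definition symbol_eq :: "nat set \<times> nat set \<Rightarrow> nat set \<times> nat set \<Rightarrow> bool" where
  "symbol_eq P Q \<longleftrightarrow>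
     finite (fst P) \<and> finite (snd P) \<and> finite (fst Q) \<and> finite (snd Q) \<and>
     equivclp (\<lambda>X Y. Y = shift_pair X) P Q"

quotient_type symbol = "nat set \<times> nat set" / partial: symbol_eq
proof (rule part_equivpI)
  show "\<exists>x. symbol_eq x x"
    by (rule exI[of _ "({}, {})"]) (simp add: symbol_eq_def)
  show "symp symbol_eq"
    by (rule sympI) (auto simp: symbol_eq_def intro: equivclp_sym)
  show "transp symbol_eq"
    by (rule transpI) (auto simp: symbol_eq_def intro: equivclp_trans)
qed

lemma finite_shift_set [simp]: "finite (shift_set A) \<longleftrightarrow> finite A"
  by (auto simp: shift_set_def dest: finite_imageD)

text \<open>Functions invariant under a single shift descend to symbols.\<close>

lemma symbol_eq_invariant:
  assumes inv: "\<And>A B. finite A \<Longrightarrow> finite B \<Longrightarrow> f (shift_set A, shift_set B) = f (A, B)"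
    and "symbol_eq P Q"
  shows "f P = f Q"
proof -
  have "equivclp (\<lambda>X Y. Y = shift_pair X) P Q" and "finite (fst P)" "finite (snd P)"
    using assms(2) by (auto simp: symbol_eq_def)
  then have "f P = f Q \<and> finite (fst Q) \<and> finite (snd Q)"
  proof (induction rule: equivclp_induct)
    case base
    then show ?case by simp
  next
    case (step X Y)
    then show ?case
      by (cases X; cases Y) (auto simp: shift_pair_def inv)
  qed
  then show ?thesis by simp
qed

lemma sum_shift_set:
  assumes "finite A"
  shows "(\<Sum>a\<in>shift_set A. g a) = g 0 + (\<Sum>a\<in>A. g (Suc a))"
  using assms by (simp add: shift_set_def sum.reindex)

lemma sum_id_shift_set: "finite A \<Longrightarrow> \<Sum>(shift_set A) = \<Sum>A + card A"
  by (simp add: sum_shift_set sum_Suc)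

lemma card_shift_set: "finite A \<Longrightarrow> card (shift_set A) = Suc (card A)"
  by (simp add: shift_set_def card_image)

lemma below_shift_set_0 [simp]: "below (shift_set A) 0 = 0"
  by (simp add: below_def)

lemma below_shift_set_Suc [simp]:
  assumes "finite A"
  shows "below (shift_set A) (Suc a) = Suc (below A a)"
proof -
  have "{x \<in> shift_set A. x < Suc a} = shift_set {x \<in> A. x < a}"
    by (auto simp: shift_set_def)
  then show ?thesis
    using assms by (simp add: below_def card_shift_set)
qed

lemma sum_below: "finite A \<Longrightarrow> 2 * (\<Sum>a\<in>A. below A a) + card A = card A * card A"
proof (induction A rule: finite_linorder_max_induct)
  case empty
  then show ?case by simp
next
  case (insert b A)
  have notin: "b \<notin> A" using insert by auto
  have 1: "below (insert b A) b = card A"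
  proof -
    have "{x \<in> insert b A. x < b} = A" using insert by auto
    then show ?thesis by (simp add: below_def)
  qed
  have 2: "below (insert b A) a = below A a" if "a \<in> A" for a
  proof -
    have "{x \<in> insert b A. x < a} = {x \<in> A. x < a}" using insert that by auto
    then show ?thesis by (simp add: below_def)
  qed
  have "(\<Sum>a\<in>insert b A. below (insert b A) a) = card A + (\<Sum>a\<in>A. below A a)"
    using insert notin by (simp add: 1 2)
  then show ?case using insert notin by simp
qed

lift_definition rk :: "symbol \<Rightarrow> int" is
  "\<lambda>(A, B). int (\<Sum>a\<in>A. a) + int (\<Sum>b\<in>B. b)
      - \<lfloor>((real (card A) + real (card B) - 1) / 2)\<^sup>2\<rfloor>"
proof (erule symbol_eq_invariant[rotated])
  fix A B :: "nat set" assume fin: "finite A" "finite B"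
  let ?x = "real (card A) + real (card B)"
  have "((real (card (shift_set A)) + real (card (shift_set B)) - 1) / 2)\<^sup>2
        = ((?x - 1) / 2)\<^sup>2 + of_int (int (card A + card B))"
    using fin by (simp add: card_shift_set power2_eq_square field_simps)
  then have "\<lfloor>((real (card (shift_set A)) + real (card (shift_set B)) - 1) / 2)\<^sup>2\<rfloor>
        = \<lfloor>((?x - 1) / 2)\<^sup>2\<rfloor> + int (card A + card B)"
    by (simp only: floor_add_int)
  then show "(case (shift_set A, shift_set B) of (A, B) \<Rightarrow> int (\<Sum>a\<in>A. a) + int (\<Sum>b\<in>B. b)
      - \<lfloor>((real (card A) + real (card B) - 1) / 2)\<^sup>2\<rfloor>) =
    (case (A, B) of (A, B) \<Rightarrow> int (\<Sum>a\<in>A. a) + int (\<Sum>b\<in>B. b)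
      - \<lfloor>((real (card A) + real (card B) - 1) / 2)\<^sup>2\<rfloor>)"
    using fin by (simp add: sum_id_shift_set del: of_nat_sum)
qed

lift_definition defect :: "symbol \<Rightarrow> int" is
  "\<lambda>(A, B). int (card A) - int (card B)"
  by (erule symbol_eq_invariant[rotated]) (simp add: card_shift_set)

definition symbols :: "nat \<Rightarrow> int \<Rightarrow> symbol set" where
  "symbols n \<delta> = {L. rk L = int n \<and> defect L = \<delta>}"

section \<open>Partitions and bi-partitions\<close>

text \<open>
  A partition (up to trailing zeros) is the multiset of its positive parts. The parts
  \<open>\<lambda>\<^sub>1 \<ge> \<lambda>\<^sub>2 \<ge> \<dots>\<close> are indexed from 0 here: \<open>nth_part \<lambda> i\<close> is \<open>\<lambda>\<close> with index \<open>i + 1\<close>,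
  and is 0 beyond the last positive part.
\<close>

type_synonym partition = "nat multiset"

definition nth_part :: "partition \<Rightarrow> nat \<Rightarrow> nat" where
  "nth_part p i = (let xs = rev (sorted_list_of_multiset p) in if i < length xs then xs ! i else 0)"

definition one_row :: "nat \<Rightarrow> partition" where
  "one_row t = (if t = 0 then {#} else {#t#})"

definition lex_less :: "partition \<Rightarrow> partition \<Rightarrow> bool" where
  "lex_less p q \<longleftrightarrow>
     (\<exists>k. (\<forall>i<k. nth_part p i = nth_part q i) \<and> nth_part p k < nth_part q k)"

definition interlaces :: "partition \<Rightarrow> partition \<Rightarrow> bool" where
  "interlaces p q \<longleftrightarrow> (\<forall>i. nth_part p (Suc i) \<le> nth_part q i \<and> nth_part q i \<le> nth_part p i)"

definition beta_partition :: "nat set \<Rightarrow> partition" where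
  "beta_partition A = filter_mset (\<lambda>k. 0 < k) (image_mset (\<lambda>a. a - below A a) (mset_set A))"

lemma beta_partition_shift_set:
  assumes "finite A"
  shows "beta_partition (shift_set A) = beta_partition A"
proof -
  have "mset_set (shift_set A) = add_mset 0 (image_mset Suc (mset_set A))"
    using assms by (simp add: shift_set_def image_mset_mset_set)
  moreover have "image_mset (\<lambda>a. a - below (shift_set A) a) (image_mset Suc (mset_set A))
      = image_mset (\<lambda>a. a - below A a) (mset_set A)"
    using assms by (simp only: multiset.map_comp comp_def below_shift_set_Suc diff_Suc_Suc)
  ultimately show ?thesis
    by (simp only: beta_partition_def image_mset_add_mset filter_mset_add_mset) simp
qed

text \<open>\<open>Upsilon L = (\<lambda>, \<mu>)\<close>, the first component coming from the top row of the symbol.\<close>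

lift_definition Upsilon :: "symbol \<Rightarrow> partition \<times> partition" is
  "\<lambda>(A, B). (beta_partition A, beta_partition B)"
  by (erule symbol_eq_invariant[rotated]) (simp add: beta_partition_shift_set)

section \<open>Groups and dual pairs\<close>

datatype sign = Plus | Minus

text \<open>
  \<open>Sp n\<close> stands for the symplectic group and \<open>Orth \<epsilon> n\<close> for the even orthogonal group of type
  \<open>\<epsilon>\<close>, both on a space of dimension \<open>2n\<close>.
\<close>

datatype classical_group = Sp nat | Orth sign nat

fun half_dim :: "classical_group \<Rightarrow> nat" where
  "half_dim (Sp n) = n"
| "half_dim (Orth _ n) = n"

fun symbols_of :: "classical_group \<Rightarrow> symbol set" where
  "symbols_of (Sp n) = {L. rk L = int n \<and> defect L mod 4 = 1}"
| "symbols_of (Orth Plus n) = {L. rk L = int n \<and> defect L mod 4 = 0}"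
| "symbols_of (Orth Minus n) = {L. rk L = int n \<and> defect L mod 4 = 2}"

fun stable_range :: "classical_group \<Rightarrow> classical_group \<Rightarrow> bool" where
  "stable_range (Orth _ n) (Sp n') \<longleftrightarrow> n' \<ge> 2 * n"
| "stable_range (Sp n) (Orth Plus n') \<longleftrightarrow> n' \<ge> 2 * n"
| "stable_range (Sp n) (Orth Minus n') \<longleftrightarrow> int n' - 1 \<ge> 2 * int n"
| "stable_range (Sp _) (Sp _) \<longleftrightarrow> False"
| "stable_range (Orth _ _) (Orth _ _) \<longleftrightarrow> False"

text \<open>The sign of the orthogonal member of a dual pair (unspecified on other pairs).\<close>

fun pair_sign :: "classical_group \<Rightarrow> classical_group \<Rightarrow> sign" where
  "pair_sign (Orth e _) (Sp _) = e"
| "pair_sign (Sp _) (Orth e _) = e"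
| "pair_sign _ _ = undefined"

text \<open>The order of a symbol, relative to the group whose unipotent character it labels.\<close>

fun ord_const :: "classical_group \<Rightarrow> int" where
  "ord_const (Sp n) = int n * (int n + 1)"
| "ord_const (Orth _ n) = (int n)\<^sup>2"

lemma sum_choose_shift:
  "(\<Sum>k=1..Suc (Suc m) div 2. (Suc (Suc m) - 2 * k) choose 2)
     = (m choose 2) + (\<Sum>k=1..m div 2. (m - 2 * k) choose 2)"
proof -
  have "(\<Sum>k=1..Suc (m div 2). (Suc (Suc m) - 2 * k) choose 2)
    = (m choose 2) + (\<Sum>k=Suc 1..Suc (m div 2). (Suc (Suc m) - 2 * k) choose 2)"
    by (subst sum.atLeast_Suc_atMost) simp_all
  also have "(\<Sum>k=Suc 1..Suc (m div 2). (Suc (Suc m) - 2 * k) choose 2)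
    = (\<Sum>k=1..m div 2. (m - 2 * k) choose 2)"
    by (subst sum.shift_bounds_cl_Suc_ivl) simp
  finally show ?thesis by simp
qed

lemma ord_shift_aux:
  assumes "finite A"
  shows "2 * int (\<Sum>a\<in>shift_set A. below (shift_set A) a * a)
    = 2 * int (\<Sum>a\<in>A. below A a * a) + 2 * int (\<Sum>A) + int (card A) * int (card A) + int (card A)"
proof -
  have "(\<Sum>a\<in>shift_set A. below (shift_set A) a * a)
     = (\<Sum>a\<in>A. below A a * a) + \<Sum>A + (\<Sum>a\<in>A. below A a) + card A"
    using assms by (simp add: sum_shift_set sum.distrib sum_Suc algebra_simps)
  moreover have "2 * (\<Sum>a\<in>A. below A a) + card A = card A * card A"
    using assms by (rule sum_below)
  ultimately show ?thesis
    by (smt (verit) of_nat_add of_nat_mult mult_2)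
qed

lemma ord_shift_max:
  assumes "finite A" "finite B"
  shows "(\<Sum>a\<in>shift_set A. \<Sum>b\<in>shift_set B. max a b)
    = (\<Sum>a\<in>A. \<Sum>b\<in>B. max a b) + card A * card B + \<Sum>A + card A + \<Sum>B + card B"
  using assms by (simp add: sum_shift_set sum.distrib sum_Suc algebra_simps)

lemma ord_shift_sq:
  assumes "finite A"
  shows "(\<Sum>a\<in>shift_set A. a * (a + 1)) = (\<Sum>a\<in>A. a * (a + 1)) + 2 * \<Sum>A + 2 * card A"
proof -
  have "Suc a * (Suc a + 1) = a * (a + 1) + (2 * a + 2)" for a by simp
  then show ?thesis
    using assms by (simp only: sum_shift_set sum.distrib sum_distrib_left[symmetric]) simp
qed

lemma choose_two_int: "2 * int (m choose 2) = int m * int m - int m"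
proof -
  have "even (m * (m - 1))" by (cases m) auto
  then have "2 * (m choose 2) = m * (m - 1)" by (simp add: choose_two)
  then have "2 * int (m choose 2) = int (m * (m - 1))" by (metis of_nat_mult of_nat_numeral)
  also have "\<dots> = int m * int m - int m" by (cases m) (auto simp: algebra_simps)
  finally show ?thesis .
qed

lift_definition symbol_ord :: "classical_group \<Rightarrow> symbol \<Rightarrow> int" is
  "\<lambda>G (A, B). let m = card A + card B in
     ord_const G
     + int (\<Sum>a\<in>A. below A a * a) + int (\<Sum>b\<in>B. below B b * b)
     + int (\<Sum>a\<in>A. \<Sum>b\<in>B. max a b)
     - int (\<Sum>a\<in>A. a * (a + 1)) - int (\<Sum>b\<in>B. b * (b + 1))
     - int (\<Sum>k=1..m div 2. (m - 2 * k) choose 2)"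
proof (erule symbol_eq_invariant[rotated])
  fix G and A B :: "nat set" assume fin: "finite A" "finite B"
  let ?m = "card A + card B"
  have m: "card (shift_set A) + card (shift_set B) = Suc (Suc ?m)"
    using fin by (simp add: card_shift_set)
  have c: "2 * int (?m choose 2) = int ?m * int ?m - int ?m" by (rule choose_two_int)
  show "(case (shift_set A, shift_set B) of (A, B) \<Rightarrow> let m = card A + card B in
     ord_const G
     + int (\<Sum>a\<in>A. below A a * a) + int (\<Sum>b\<in>B. below B b * b)
     + int (\<Sum>a\<in>A. \<Sum>b\<in>B. max a b)
     - int (\<Sum>a\<in>A. a * (a + 1)) - int (\<Sum>b\<in>B. b * (b + 1))
     - int (\<Sum>k=1..m div 2. (m - 2 * k) choose 2)) =
    (case (A, B) of (A, B) \<Rightarrow> let m = card A + card B in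
     ord_const G
     + int (\<Sum>a\<in>A. below A a * a) + int (\<Sum>b\<in>B. below B b * b)
     + int (\<Sum>a\<in>A. \<Sum>b\<in>B. max a b)
     - int (\<Sum>a\<in>A. a * (a + 1)) - int (\<Sum>b\<in>B. b * (b + 1))
     - int (\<Sum>k=1..m div 2. (m - 2 * k) choose 2))"
    unfolding Let_def prod.case m sum_choose_shift
      ord_shift_max[OF fin] ord_shift_sq[OF fin(1)] ord_shift_sq[OF fin(2)]
    using ord_shift_aux[OF fin(1)] ord_shift_aux[OF fin(2)] c
    by (simp del: of_nat_sum add: algebra_simps)
qed

section \<open>The correspondence\<close>

text \<open>Writing the defect as \<open>4d + 1\<close>, \<open>4d\<close> or \<open>4d + 2\<close>, one has \<open>d = \<delta> div 4\<close> in each case.\<close>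

fun target_defect :: "sign \<Rightarrow> int \<Rightarrow> int" where
  "target_defect Plus \<delta> = - \<delta> + 1"
| "target_defect Minus \<delta> = - \<delta> - 1"

fun theta_tau :: "sign \<Rightarrow> nat \<Rightarrow> nat \<Rightarrow> int \<Rightarrow> int" where
  "theta_tau Plus n n' \<delta> = int n' - int n + 2 * (\<delta> div 4)"
| "theta_tau Minus n n' \<delta> = int n' - int n - 1 - 2 * (\<delta> div 4)"

fun theta_related :: "sign \<Rightarrow> partition \<times> partition \<Rightarrow> partition \<times> partition \<Rightarrow> bool" where
  "theta_related Plus (l, m) (l', m') \<longleftrightarrow> interlaces l' m \<and> interlaces l m'"
| "theta_related Minus (l, m) (l', m') \<longleftrightarrow> interlaces m' l \<and> interlaces m l'"

definition Theta :: "classical_group \<Rightarrow> classical_group \<Rightarrow> symbol \<Rightarrow> symbol set" where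
  "Theta G G' L =
     {L' \<in> symbols (half_dim G') (target_defect (pair_sign G G') (defect L)).
        theta_related (pair_sign G G') (Upsilon L) (Upsilon L')}"

fun add_row :: "sign \<Rightarrow> nat \<Rightarrow> partition \<times> partition \<Rightarrow> partition \<times> partition" where
  "add_row Plus t (l, m) = (m + one_row t, l)"
| "add_row Minus t (l, m) = (m, l + one_row t)"

text \<open>Meaningful when \<open>theta_tau\<close> is non-negative, in which case the symbol exists and is unique.\<close>

definition theta_lower :: "classical_group \<Rightarrow> classical_group \<Rightarrow> symbol \<Rightarrow> symbol" where
  "theta_lower G G' L =
     (THE L'. L' \<in> symbols (half_dim G') (target_defect (pair_sign G G') (defect L)) \<and>
        Upsilon L' =
          add_row (pair_sign G G')
            (nat (theta_tau (pair_sign G G') (half_dim G) (half_dim G') (defect L)))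
            (Upsilon L))"

text \<open>The comparison for \<open>Minus\<close> gives priority to the second component.\<close>

fun bipartition_less :: "sign \<Rightarrow> partition \<times> partition \<Rightarrow> partition \<times> partition \<Rightarrow> bool" where
  "bipartition_less Plus (p, q) (p', q') \<longleftrightarrow>
     sum_mset p < sum_mset p' \<or>
     sum_mset p = sum_mset p' \<and> (lex_less p p' \<or> p = p' \<and> lex_less q q')"
| "bipartition_less Minus (q, p) (q', p') \<longleftrightarrow>
     sum_mset p < sum_mset p' \<or>
     sum_mset p = sum_mset p' \<and> (lex_less p p' \<or> p = p' \<and> lex_less q q')"

definition symbol_less :: "sign \<Rightarrow> symbol \<Rightarrow> symbol \<Rightarrow> bool" where
  "symbol_less e L1 L2 \<longleftrightarrow> bipartition_less e (Upsilon L1) (Upsilon L2)"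

definition max_ord_elements :: "classical_group \<Rightarrow> symbol set \<Rightarrow> symbol set" where
  "max_ord_elements G X = {L \<in> X. \<forall>L1\<in>X. symbol_ord G L1 \<le> symbol_ord G L}"

definition smallest :: "sign \<Rightarrow> symbol set \<Rightarrow> symbol" where
  "smallest e X = (THE L. L \<in> X \<and> (\<forall>L1\<in>X. L1 \<noteq> L \<longrightarrow> symbol_less e L L1))"

text \<open>
  For the recursion defining \<open>theta_upper\<close>: the lexicographic order is contained in the
  well-founded multiset order.
\<close>

lemma count_nth_part:
  assumes "0 < v"
  shows "count p v = card {i. nth_part p i = v}" and "finite {i. nth_part p i = v}"
proof -
  let ?xs = "rev (sorted_list_of_multiset p)"
  have eq: "{i. nth_part p i = v} = {i. i < length ?xs \<and> ?xs ! i = v}"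
    using assms by (auto simp: nth_part_def Let_def)
  have "count p v = count (mset ?xs) v" by simp
  also have "\<dots> = length (filter (\<lambda>y. y = v) ?xs)"
    by (metis (mono_tags, lifting) count_mset filter_cong count_list_eq_length_filter)
  also have "\<dots> = card {i. i < length ?xs \<and> ?xs ! i = v}"
    by (rule length_filter_conv_card)
  finally show "count p v = card {i. nth_part p i = v}" by (simp only: eq)
  show "finite {i. nth_part p i = v}" unfolding eq by simp
qed

lemma nth_part_antimono: "i \<le> j \<Longrightarrow> nth_part p j \<le> nth_part p i"
  by (auto simp: nth_part_def Let_def rev_nth intro!: sorted_nth_mono)

lemma lex_less_imp_less: "lex_less p q \<Longrightarrow> p < q"
proof -
  assume "lex_less p q"
  then obtain k where eq: "\<And>i. i < k \<Longrightarrow> nth_part p i = nth_part q i"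
    and lt: "nth_part p k < nth_part q k" by (auto simp: lex_less_def)
  let ?v = "nth_part q k"
  have v: "0 < ?v" using lt by simp
  have small: "nth_part p i < ?v" if "k \<le> i" for i
    using nth_part_antimono[OF that, of p] lt by simp
  have above: "count p y = count q y" if "?v < y" for y
  proof -
    have "i < k" if "nth_part p i = y \<or> nth_part q i = y" for i
      using that \<open>?v < y\<close> small[of i] nth_part_antimono[of k i q] by (cases "k \<le> i") auto
    then have "nth_part p i = y \<longleftrightarrow> nth_part q i = y" for i by (metis eq)
    then have "{i. nth_part p i = y} = {i. nth_part q i = y}" by (rule Collect_cong)
    moreover have "0 < y" using that by simp
    ultimately show ?thesis by (simp only: count_nth_part(1))
  qed
  have "{i. nth_part p i = ?v} \<subset> {i. nth_part q i = ?v}"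
  proof (rule psubsetI)
    show "{i. nth_part p i = ?v} \<subseteq> {i. nth_part q i = ?v}"
    proof
      fix i assume "i \<in> {i. nth_part p i = ?v}"
      moreover from this have "i < k" using small[of i] by (cases "k \<le> i") auto
      ultimately show "i \<in> {i. nth_part q i = ?v}" using eq by simp
    qed
    have "k \<in> {i. nth_part q i = ?v}" "k \<notin> {i. nth_part p i = ?v}" using lt by auto
    then show "{i. nth_part p i = ?v} \<noteq> {i. nth_part q i = ?v}" by blast
  qed
  then have at: "count p ?v < count q ?v"
    unfolding count_nth_part(1)[OF v] by (rule psubset_card_mono[OF count_nth_part(2)[OF v]])
  show "p < q"
    unfolding less_multiset\<^sub>H\<^sub>O
  proof (intro conjI allI impI)
    show "p \<noteq> q" using at by auto
    fix y assume y: "count q y < count p y"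
    then have "y < ?v" using above[of y] at by (cases y ?v rule: linorder_cases) auto
    then show "\<exists>x>y. count p x < count q x" using at by blast
  qed
qed

definition bipartition_key :: "sign \<Rightarrow> partition \<times> partition \<Rightarrow> nat \<times> partition \<times> partition" where
  "bipartition_key e pq = (case e of
      Plus \<Rightarrow> (sum_mset (fst pq), fst pq, snd pq)
    | Minus \<Rightarrow> (sum_mset (snd pq), snd pq, fst pq))"

lemma bipartition_less_key:
  "bipartition_less e P Q \<Longrightarrow>
     (bipartition_key e P, bipartition_key e Q)
       \<in> less_than <*lex*> {(x, y). x < y} <*lex*> {(x, y). x < y}"
  by (cases e; cases P; cases Q) (auto simp: bipartition_key_def dest: lex_less_imp_less)

function theta_upper :: "classical_group \<Rightarrow> classical_group \<Rightarrow> symbol \<Rightarrow> symbol" where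
  "theta_upper G G' L =
     smallest (pair_sign G G')
       (max_ord_elements G'
         (Theta G G' L -
           theta_upper G G' ` {L1 \<in> symbols (half_dim G) (defect L). symbol_less (pair_sign G G') L1 L}))"
  by pat_completeness auto
termination
proof (relation "inv_image (less_than <*lex*> {(x, y). x < y} <*lex*> {(x, y). x < y})
    (\<lambda>(G, G', L). bipartition_key (pair_sign G G') (Upsilon L))")
  show "wf (inv_image (less_than <*lex*> {(x, y). x < y} <*lex*> {(x, y). x < y})
    (\<lambda>(G, G', L). bipartition_key (pair_sign G G') (Upsilon L)))"
    by (intro wf_inv_image wf_lex_prod wf_less_than wf)
qed (auto simp: symbol_less_def dest: bipartition_less_key simp del: in_lex_prod)

declare theta_upper.simps [simp del]

end

theory Submission
  imports Defs
begin

text \<open>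
  In the stable range the symbol \<open>theta_lower G G' L\<close> is the only element of maximal order of the
  whole set \<open>Theta G G' L\<close>. As \<open>theta_lower\<close> is injective on the symbols of a given rank and defect,
  an induction along the recursion of \<open>theta_upper\<close> shows that it is never among the
  values removed earlier; what \<open>theta_upper\<close> selects from is then the singleton of it.

  The reason for the maximality, for the sign \<open>Plus\<close>: let \<open>L\<close> have bi-partition \<open>(\<lambda>, \<mu>)\<close>, and let
  \<open>(\<lambda>', \<mu>')\<close> be the bi-partition of an element of \<open>Theta G G' L\<close>. Interlacing bounds the rows of \<open>\<lambda>'\<close>
  after the first by the rows of \<open>\<mu>\<close>, and the rows of \<open>\<mu>'\<close> by those of \<open>\<lambda>\<close>, while the total number
  of boxes is \<open>\<tau> + |\<lambda>| + |\<mu>|\<close>. Hence \<open>(\<lambda>', \<mu>')\<close> arises from the bi-partition \<open>(\<mu> \<union> [\<tau>], \<lambda>)\<close> of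
  \<open>theta_lower G G' L\<close> by removing \<open>k\<close> boxes from the other rows and adding them to the row \<open>\<tau>\<close>.
  For \<open>k > 0\<close> such a move strictly lowers the order (\<open>raising_top_entry_lowers_order\<close>), provided
  that the entry of the symbol that belongs to the row \<open>\<tau>\<close> is at least as large as all others.

  This proviso is what the stable range gives (\<open>stable_range_bounds\<close>). It follows from
  \<open>\<tau> \<ge> |\<lambda>| + |\<mu>|\<close> and \<open>\<tau> + \<delta>' \<ge> |\<lambda>| + |\<mu>|\<close>, where the target defect \<open>\<delta>'\<close> may be very negative; but the
  rank of \<open>L\<close> exceeds \<open>|\<lambda>| + |\<mu>|\<close> by about a quarter of the square of the defect, and \<open>\<tau>\<close> is at least
  the rank up to a term linear in the defect. The sign \<open>Minus\<close> is the same with the two rows of all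
  target symbols exchanged.
\<close>

section \<open>Parts of a partition\<close>

lemma nth_part_beyond: "size p \<le> i \<Longrightarrow> nth_part p i = 0"
  by (simp add: nth_part_def Let_def flip: size_mset)

lemma nth_part_member: "nth_part p i = 0 \<or> nth_part p i \<in># p"
proof -
  have "rev (sorted_list_of_multiset p) ! i \<in># p" if "i < size p"
  proof -
    have "i < length (rev (sorted_list_of_multiset p))"
      using that by (simp flip: size_mset)
    then have "rev (sorted_list_of_multiset p) ! i \<in> set (rev (sorted_list_of_multiset p))"
      by (rule nth_mem)
    then show ?thesis by simp
  qed
  then show ?thesis
    using nth_part_beyond[of p i] by (auto simp: nth_part_def Let_def simp flip: size_mset)
qed

text \<open>
  Partitions are multisets, but interlacing and beta-sets see them as sequences of parts. This
  recovers a partition without zeros from any initial segment of its sequence that contains all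
  positive parts.
\<close>

lemma mset_nth_part:
  assumes "0 \<notin># p" and "size p \<le> m"
  shows "filter_mset (\<lambda>k. 0 < k) (image_mset (nth_part p) (mset_set {..<m})) = p"
proof (rule multiset_eqI)
  fix v
  show "count (filter_mset (\<lambda>k. 0 < k) (image_mset (nth_part p) (mset_set {..<m}))) v = count p v"
  proof (cases "v = 0")
    case True
    then show ?thesis using assms by (simp add: not_in_iff)
  next
    case False
    then have "i < m" if "nth_part p i = v" for i
      using assms(2) nth_part_beyond[of p i] that by (cases "i < size p") auto
    then have "{i. i < m \<and> v = nth_part p i} = {i. nth_part p i = v}" by blast
    moreover have "(\<Sum>i | i < m \<and> v = nth_part p i. count (mset_set {..<m}) i)
        = card {i. i < m \<and> v = nth_part p i}"
      by simp
    moreover have "count p v = card {i. nth_part p i = v}"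
      using False by (simp add: count_nth_part)
    ultimately show ?thesis
      using False by (simp add: count_image_mset')
  qed
qed

lemma partition_eqI:
  assumes "0 \<notin># p" "0 \<notin># q" and "\<And>i. nth_part p i = nth_part q i"
  shows "p = q"
proof -
  have "nth_part p = nth_part q" using assms(3) by blast
  then show ?thesis
    using mset_nth_part[of p "size p + size q"] mset_nth_part[of q "size p + size q"] assms(1,2)
    by (metis le_add1 le_add2)
qed

lemma sum_nth_part:
  assumes "0 \<notin># p" and "size p \<le> m"
  shows "(\<Sum>i<m. nth_part p i) = sum_mset p"
proof -
  have drop_zeros: "sum_mset (filter_mset (\<lambda>k. 0 < k) M) = sum_mset M" for M :: "nat multiset"
    by (induction M) auto
  show ?thesis
    using drop_zeros[of "image_mset (nth_part p) (mset_set {..<m})"] mset_nth_part[OF assms]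
    by (simp add: sum_unfold_sum_mset)
qed

lemma member_le_sum:
  fixes p :: partition
  assumes "x \<in># p"
  shows "x \<le> sum_mset p"
  using multi_member_split[OF assms] by auto

lemma part_le_sum: "nth_part p i \<le> sum_mset p"
  using nth_part_member[of p i] member_le_sum by auto

text \<open>
  For \<open>t = 0\<close> no part is added; the hypothesis then makes all parts vanish, so that the shifted
  sequence is the old one.
\<close>

lemma nth_part_add_row:
  assumes "\<forall>x\<in>#p. x \<le> t"
  shows "nth_part (p + one_row t) 0 = t"
    and "nth_part (p + one_row t) (Suc i) = nth_part p i"
proof -
  have zero: "nth_part p j = 0" if "t = 0" for j
    using nth_part_member[of p j] assms that by auto
  have "sorted_list_of_multiset (add_mset t p) = sorted_list_of_multiset p @ [t]"
    using assms by (simp add: sorted_insort_is_snoc)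
  then have *: "rev (sorted_list_of_multiset (add_mset t p)) = t # rev (sorted_list_of_multiset p)"
    by simp
  have add: "nth_part (add_mset t p) 0 = t" "nth_part (add_mset t p) (Suc i) = nth_part p i"
    unfolding nth_part_def Let_def * by simp_all
  show "nth_part (p + one_row t) 0 = t"
    using zero add by (simp add: one_row_def)
  show "nth_part (p + one_row t) (Suc i) = nth_part p i"
    using zero add by (simp add: one_row_def)
qed

section \<open>Beta-sets\<close>

text \<open>
  The decreasing list of entries, indexed from 0, of the beta-set with \<open>m\<close> elements that encodes
  \<open>p\<close>.
\<close>

definition entry :: "nat \<Rightarrow> partition \<Rightarrow> nat \<Rightarrow> nat" where
  "entry m p i = nth_part p i + (m - 1 - i)"

definition beta_set :: "nat \<Rightarrow> partition \<Rightarrow> nat set" where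
  "beta_set m p = entry m p ` {..<m}"

lemma entry_less: "i < j \<Longrightarrow> j < m \<Longrightarrow> entry m p j < entry m p i"
  using nth_part_antimono[of i j p] by (simp add: entry_def)

lemma entry_less_iff: "i < m \<Longrightarrow> j < m \<Longrightarrow> entry m p j < entry m p i \<longleftrightarrow> i < j"
  by (metis entry_less less_asym' linorder_neqE_nat less_irrefl)

lemma inj_on_entry: "inj_on (entry m p) {..<m}"
  by (metis entry_less inj_onI lessThan_iff less_irrefl linorder_neqE_nat)

lemma finite_beta_set [simp]: "finite (beta_set m p)"
  by (simp add: beta_set_def)

lemma card_beta_set [simp]: "card (beta_set m p) = m"
  by (simp add: beta_set_def card_image inj_on_entry)

lemma below_beta_set:
  assumes "i < m"
  shows "below (beta_set m p) (entry m p i) = m - 1 - i"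
proof -
  have "{x \<in> beta_set m p. x < entry m p i} = entry m p ` {i<..<m}"
    using assms entry_less_iff by (auto simp: beta_set_def)
  moreover have "inj_on (entry m p) {i<..<m}"
    by (rule inj_on_subset[OF inj_on_entry]) auto
  ultimately show ?thesis by (simp add: below_def card_image)
qed

lemma sum_beta_set: "(\<Sum>x\<in>beta_set m p. g x) = (\<Sum>i<m. g (entry m p i))"
  by (simp add: beta_set_def sum.reindex inj_on_entry)

lemma beta_partition_beta_set:
  assumes "0 \<notin># p" and "size p \<le> m"
  shows "beta_partition (beta_set m p) = p"
proof -
  have "mset_set (beta_set m p) = image_mset (entry m p) (mset_set {..<m})"
    by (simp add: beta_set_def image_mset_mset_set inj_on_entry)
  then have "image_mset (\<lambda>a. a - below (beta_set m p) a) (mset_set (beta_set m p))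
      = image_mset (\<lambda>i. entry m p i - below (beta_set m p) (entry m p i)) (mset_set {..<m})"
    by (simp add: multiset.map_comp comp_def)
  also have "\<dots> = image_mset (nth_part p) (mset_set {..<m})"
    by (rule image_mset_cong) (simp add: below_beta_set, simp add: entry_def)
  finally show ?thesis
    unfolding beta_partition_def using mset_nth_part[OF assms] by simp
qed

lemma shift_beta_set:
  assumes "size p \<le> m"
  shows "shift_set (beta_set m p) = beta_set (Suc m) p"
proof -
  have "Suc ` beta_set m p = entry (Suc m) p ` {..<m}"
    unfolding beta_set_def image_image by (rule image_cong) (auto simp: entry_def)
  \<comment> \<open>The new smallest entry comes from the zero part at index \<open>m\<close>.\<close>
  moreover have "entry (Suc m) p m = 0"
    using assms by (simp add: entry_def nth_part_beyond)
  ultimately show ?thesis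
    by (simp add: shift_set_def beta_set_def lessThan_Suc)
qed

text \<open>
  Induction on the size of the beta-set: a new largest element \<open>b\<close> of a set with \<open>m\<close> elements
  contributes a new longest row, of length \<open>b - m\<close>.
\<close>

lemma beta_set_exists:
  assumes "finite A"
  shows "\<exists>p. 0 \<notin># p \<and> size p \<le> card A \<and> A = beta_set (card A) p"
  using assms
proof (induction A rule: finite_linorder_max_induct)
  case empty
  show ?case by (rule exI[of _ "{#}"]) (simp add: beta_set_def)
next
  case (insert b A)
  define m where "m = card A"
  from insert obtain p where p: "0 \<notin># p" "size p \<le> m" "A = beta_set m p"
    unfolding m_def by blast
  define t where "t = b - m"
  have card: "card (insert b A) = Suc m"
    using insert by (auto simp: m_def)
  \<comment> \<open>The largest entry of \<open>A\<close> is the longest row plus \<open>m - 1\<close>, and it is less than \<open>b\<close>.\<close>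
  have large: "x + m \<le> b" if "x \<in># p" for x
  proof -
    have "x \<noteq> 0" using p(1) that by (cases "x = 0") auto
    then have "card {i. nth_part p i = x} = count p x"
      by (simp add: count_nth_part(1))
    moreover have "count p x \<noteq> 0"
      using that by simp
    ultimately have "{i. nth_part p i = x} \<noteq> {}"
      by (metis card.empty)
    then obtain i where i: "nth_part p i = x" by blast
    then have "i < size p"
      using i \<open>x \<noteq> 0\<close> nth_part_beyond[of p i] by (cases "i < size p") auto
    then have "0 < m" using p by simp
    then have "entry m p 0 \<in> A" using p by (auto simp: beta_set_def)
    then have "entry m p 0 < b" using insert by blast
    then show ?thesis
      using \<open>0 < m\<close> i nth_part_antimono[of 0 i p] by (simp add: entry_def)
  qed
  have "m \<le> b"
  proof (cases "m = 0")
    case False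
    then have "entry m p 0 \<in> A" using p by (auto simp: beta_set_def)
    then have "entry m p 0 < b" using insert by blast
    then show ?thesis by (simp add: entry_def)
  qed simp
  have "\<forall>x\<in>#p. x \<le> t"
    using large by (fastforce simp: t_def)
  note row = nth_part_add_row[OF this]
  have "entry (Suc m) (p + one_row t) 0 = b"
    using \<open>m \<le> b\<close> row(1) by (simp add: entry_def t_def)
  moreover have "(\<lambda>i. entry (Suc m) (p + one_row t) (Suc i)) ` {..<m} = A"
    unfolding p(3) beta_set_def by (rule image_cong) (auto simp: entry_def row)
  ultimately have "insert b A = beta_set (Suc m) (p + one_row t)"
    by (simp add: beta_set_def lessThan_Suc_eq_insert_0 image_image)
  moreover have "0 \<notin># p + one_row t" "size (p + one_row t) \<le> Suc m"
    using p by (auto simp: one_row_def)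
  ultimately show ?case unfolding card by blast
qed

lemma beta_set_beta_partition:
  assumes "finite A"
  shows "0 \<notin># beta_partition A" "size (beta_partition A) \<le> card A"
    "A = beta_set (card A) (beta_partition A)"
  using beta_set_exists[OF assms] beta_partition_beta_set by metis+

section \<open>Symbols as bi-partitions with a defect\<close>

definition symbol_of :: "nat \<Rightarrow> nat \<Rightarrow> partition \<Rightarrow> partition \<Rightarrow> symbol" where
  "symbol_of m1 m2 p q = abs_symbol (beta_set m1 p, beta_set m2 q)"

lemma symbol_eq_refl_iff: "symbol_eq P P \<longleftrightarrow> finite (fst P) \<and> finite (snd P)"
  by (auto simp: symbol_eq_def)

lemma abs_symbol_shift:
  assumes "finite A" "finite B"
  shows "abs_symbol (shift_set A, shift_set B) = abs_symbol (A, B)"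
proof (rule Quotient_rel_abs[OF Quotient_symbol, symmetric])
  show "symbol_eq (A, B) (shift_set A, shift_set B)"
    using assms by (auto simp: symbol_eq_def shift_pair_def)
qed

lemma symbol_of_shift:
  assumes "size p \<le> m1" "size q \<le> m2"
  shows "symbol_of (m1 + k) (m2 + k) p q = symbol_of m1 m2 p q"
proof (induction k)
  case (Suc k)
  then show ?case
    using assms shift_beta_set[of p "m1 + k"] shift_beta_set[of q "m2 + k"]
      abs_symbol_shift[of "beta_set (m1 + k) p" "beta_set (m2 + k) q"]
    by (simp add: symbol_of_def)
qed simp

lemma Upsilon_symbol_of:
  assumes "0 \<notin># p" "0 \<notin># q" "size p \<le> m1" "size q \<le> m2"
  shows "Upsilon (symbol_of m1 m2 p q) = (p, q)"
  using assms
  by (simp add: symbol_of_def Upsilon.abs_eq symbol_eq_refl_iff beta_partition_beta_set)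

lemma defect_symbol_of: "defect (symbol_of m1 m2 p q) = int m1 - int m2"
  by (simp add: symbol_of_def defect.abs_eq symbol_eq_refl_iff)

text \<open>
  A symbol is determined by its defect and its bi-partition, and its representative can be taken
  with any sufficiently large row lengths of the right difference: two representatives become
  equal when each is shifted by the number of top entries of the other.
\<close>

lemma symbol_eq_symbol_of:
  assumes "Upsilon L = (p, q)"
  shows "0 \<notin># p" "0 \<notin># q"
    and "int m1 - int m2 = defect L \<Longrightarrow> size p \<le> m1 \<Longrightarrow> size q \<le> m2 \<Longrightarrow> L = symbol_of m1 m2 p q"
proof -
  obtain A B where AB: "rep_symbol L = (A, B)" by fastforce
  have "symbol_eq (A, B) (A, B)"
    using Quotient_rep_reflp[OF Quotient_symbol, of L] AB by simp
  then have fin: "finite A" "finite B" by (simp_all add: symbol_eq_def)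
  have L: "L = abs_symbol (A, B)"
    using Quotient_abs_rep[OF Quotient_symbol, of L] AB by simp
  have pq: "p = beta_partition A" "q = beta_partition B"
    using assms fin by (simp_all add: L Upsilon.abs_eq symbol_eq_refl_iff)
  note A = beta_set_beta_partition[OF fin(1), folded pq]
  note B = beta_set_beta_partition[OF fin(2), folded pq]
  show "0 \<notin># p" "0 \<notin># q" by fact+
  assume m: "int m1 - int m2 = defect L" "size p \<le> m1" "size q \<le> m2"
  have LAB: "L = symbol_of (card A) (card B) p q"
    using A(3) B(3) by (simp add: symbol_of_def L)
  then have "m1 + card B = m2 + card A"
    using m(1) by (simp add: defect_symbol_of)
  moreover have "symbol_of (m1 + card A) (m2 + card A) p q = symbol_of m1 m2 p q"
    using m by (intro symbol_of_shift)
  moreover have "symbol_of (card A + m1) (card B + m1) p q = L"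
    unfolding LAB using A B by (intro symbol_of_shift)
  ultimately show "L = symbol_of m1 m2 p q" by (simp add: add.commute)
qed

lemma row_lengths_exist:
  obtains m1 m2 :: nat where "int m1 - int m2 = \<delta>" "N \<le> m1" "N \<le> m2"
proof
  show "int (N + nat \<delta>) - int (N + nat (- \<delta>)) = \<delta>" by simp
qed simp_all

lemma symbol_eqI:
  assumes "Upsilon L = Upsilon L'" "defect L = defect L'"
  shows "L = L'"
proof -
  obtain p q where pq: "Upsilon L = (p, q)" by fastforce
  obtain m1 m2 where m: "int m1 - int m2 = defect L" "size p + size q \<le> m1" "size p + size q \<le> m2"
    by (rule row_lengths_exist)
  then show ?thesis
    using symbol_eq_symbol_of(3)[of L p q m1 m2] symbol_eq_symbol_of(3)[of L' p q m1 m2] assms pq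
    by simp
qed

lemma symbol_exists:
  assumes "0 \<notin># p" "0 \<notin># q"
  obtains L where "Upsilon L = (p, q)" "defect L = \<delta>"
proof -
  obtain m1 m2 where "int m1 - int m2 = \<delta>" "size p + size q \<le> m1" "size p + size q \<le> m2"
    by (rule row_lengths_exist)
  then show ?thesis
    using assms by (intro that[of "symbol_of m1 m2 p q"]) (simp_all add: Upsilon_symbol_of defect_symbol_of)
qed

lemma sum_entry:
  assumes "0 \<notin># p" "size p \<le> m"
  shows "2 * int (\<Sum>i<m. entry m p i) = 2 * int (sum_mset p) + int m * (int m - 1)"
proof -
  have "2 * (\<Sum>i<m. int (m - 1 - i)) = int m * (int m - 1)"
  proof -
    have "(\<Sum>i<m. int (m - 1 - i)) = (\<Sum>i<m. int i)"
      by (subst sum.nat_diff_reindex[symmetric]) simp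
    also have "2 * \<dots> = int m * (int m - 1)"
      by (induction m) (auto simp: algebra_simps)
    finally show ?thesis .
  qed
  then show ?thesis
    unfolding entry_def sum.distrib sum_nth_part[OF assms]
    by (simp only: of_nat_add of_nat_sum distrib_left)
qed

lemma square_div_4: "\<lfloor>(real_of_int s / 2)\<^sup>2\<rfloor> = s\<^sup>2 div 4"
  using floor_divide_of_int_eq[of "s\<^sup>2" 4, where 'a = real] by (simp add: power_divide)

lemma even_square_div_4: "(2 * k)\<^sup>2 div 4 = k * k" for k :: int
  by (simp add: power2_eq_square)

lemma odd_square_div_4: "(2 * k + 1)\<^sup>2 div 4 = k * k + k" for k :: int
proof -
  have "(2 * k + 1)\<^sup>2 = 1 + (k * k + k) * 4" by (simp add: power2_eq_square algebra_simps)
  then show ?thesis by (simp only: div_mult_self1)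
qed

text \<open>
  With row lengths \<open>m1\<close> and \<open>m2\<close>, the squares of the defect \<open>x = m1 - m2\<close> and of
  \<open>y = m1 + m2 - 1\<close> add up to one more than twice \<open>m1 (m1 - 1) + m2 (m2 - 1)\<close>; as \<open>x\<close> and \<open>y\<close>
  have different parity, rounding their quarters down loses exactly that one.
\<close>

lemma rk_eq:
  assumes "Upsilon L = (p, q)"
  shows "rk L = int (sum_mset p) + int (sum_mset q) + (defect L)\<^sup>2 div 4"
proof -
  obtain m1 m2 where m: "int m1 - int m2 = defect L" "size p + size q \<le> m1" "size p + size q \<le> m2"
    by (rule row_lengths_exist)
  note pq = symbol_eq_symbol_of(1,2)[OF assms]
  have L: "L = symbol_of m1 m2 p q"
    using m by (intro symbol_eq_symbol_of[OF assms]) auto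
  define x y where "x = int m1 - int m2" and "y = int m1 + int m2 - 1"
  have "rk L = int (\<Sum>i<m1. entry m1 p i) + int (\<Sum>i<m2. entry m2 q i) - y\<^sup>2 div 4"
    using square_div_4[of y]
    by (simp add: L symbol_of_def rk.abs_eq symbol_eq_refl_iff sum_beta_set y_def)
  moreover have "2 * int (\<Sum>i<m1. entry m1 p i) = 2 * int (sum_mset p) + int m1 * (int m1 - 1)"
    using pq m by (intro sum_entry) auto
  moreover have "2 * int (\<Sum>i<m2. entry m2 q i) = 2 * int (sum_mset q) + int m2 * (int m2 - 1)"
    using pq m by (intro sum_entry) auto
  moreover have "2 * (x\<^sup>2 div 4) + 2 * (y\<^sup>2 div 4) = int m1 * (int m1 - 1) + int m2 * (int m2 - 1)"
  proof -
    have square: "x\<^sup>2 + y\<^sup>2 = 2 * (int m1 * (int m1 - 1) + int m2 * (int m2 - 1)) + 1"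
      by (simp add: x_def y_def power2_eq_square algebra_simps)
    have "odd x = even y" by (simp add: x_def y_def)
    then consider (even) k l where "x = 2 * k" "y = 2 * l + 1" | (odd) k l where "x = 2 * k + 1" "y = 2 * l"
      by (cases "even x") (auto elim!: evenE oddE)
    then have "4 * (x\<^sup>2 div 4) + 4 * (y\<^sup>2 div 4) + 1 = x\<^sup>2 + y\<^sup>2"
    proof cases
      case even
      then show ?thesis by (simp only: even_square_div_4 odd_square_div_4) (simp add: power2_eq_square algebra_simps)
    next
      case odd
      then show ?thesis by (simp only: even_square_div_4 odd_square_div_4) (simp add: power2_eq_square algebra_simps)
    qed
    then show ?thesis using square by (simp add: algebra_simps)
  qed
  ultimately have "2 * rk L = 2 * int (sum_mset p) + 2 * int (sum_mset q) + 2 * (x\<^sup>2 div 4)"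
    by linarith
  then show ?thesis using m(1) by (simp add: x_def)
qed

section \<open>The order of a symbol\<close>

text \<open>
  What the entry \<open>x\<close> at index \<open>i\<close> of a row of length \<open>m\<close> contributes to the order by itself: it is the
  larger member of \<open>m - 1 - i\<close> pairs within its row.
\<close>

definition entry_ord :: "nat \<Rightarrow> nat \<Rightarrow> int \<Rightarrow> int" where
  "entry_ord m i x = (int m - 1 - int i) * x - x * (x + 1)"

text \<open>
  The part of the order that depends on more than the group and the number of entries.
\<close>

definition pair_ord :: "nat \<Rightarrow> partition \<Rightarrow> nat \<Rightarrow> partition \<Rightarrow> int" where
  "pair_ord m1 p m2 q =
     (\<Sum>i<m1. entry_ord m1 i (int (entry m1 p i))) + (\<Sum>j<m2. entry_ord m2 j (int (entry m2 q j)))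
     + (\<Sum>i<m1. \<Sum>j<m2. max (int (entry m1 p i)) (int (entry m2 q j)))"

lemma pair_ord_commute: "pair_ord m1 p m2 q = pair_ord m2 q m1 p"
proof -
  have "(\<Sum>i<m1. \<Sum>j<m2. max (int (entry m1 p i)) (int (entry m2 q j)))
      = (\<Sum>j<m2. \<Sum>i<m1. max (int (entry m2 q j)) (int (entry m1 p i)))"
    by (subst sum.swap) (simp add: max.commute)
  then show ?thesis by (simp add: pair_ord_def)
qed

lemma symbol_ord_symbol_of:
  "symbol_ord G (symbol_of m1 m2 p q) =
     ord_const G - int (\<Sum>k=1..(m1 + m2) div 2. (m1 + m2 - 2 * k) choose 2) + pair_ord m1 p m2 q"
proof -
  have row: "int (\<Sum>a\<in>beta_set m p. below (beta_set m p) a * a) - int (\<Sum>a\<in>beta_set m p. a * (a + 1))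
      = (\<Sum>i<m. entry_ord m i (int (entry m p i)))" for m p
  proof -
    have "(\<Sum>a\<in>beta_set m p. below (beta_set m p) a * a) = (\<Sum>i<m. (m - 1 - i) * entry m p i)"
      unfolding sum_beta_set by (rule sum.cong) (simp_all add: below_beta_set)
    moreover have "int (\<Sum>i<m. (m - 1 - i) * entry m p i) = (\<Sum>i<m. (int m - 1 - int i) * int (entry m p i))"
      unfolding of_nat_sum by (rule sum.cong) auto
    ultimately show ?thesis
      by (simp only: sum_beta_set entry_ord_def sum_subtractf of_nat_sum of_nat_mult of_nat_add of_nat_1)
  qed
  have cross: "int (\<Sum>a\<in>beta_set m1 p. \<Sum>b\<in>beta_set m2 q. max a b)
      = (\<Sum>i<m1. \<Sum>j<m2. max (int (entry m1 p i)) (int (entry m2 q j)))"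
    by (simp add: sum_beta_set of_nat_max)
  show ?thesis
    unfolding symbol_of_def
    by (subst symbol_ord.abs_eq)
      (simp_all add: symbol_eq_refl_iff Let_def pair_ord_def row[symmetric] cross[symmetric] del: of_nat_sum)
qed

text \<open>
  The sum counts the entries above \<open>x\<close> twice and an entry equal to \<open>x\<close> once. The entries are
  distinct integers, so at most \<open>t - x\<close> of them lie in \<open>{x<..t}\<close>.
\<close>

lemma sum_one_minus_sgn:
  fixes v :: "nat \<Rightarrow> int"
  assumes "inj_on v {..<n}" and "\<And>i. i < n \<Longrightarrow> v i \<le> t" and "x \<le> t"
  shows "(\<Sum>i<n. 1 - sgn (x - v i)) \<le> 2 * (t - x) + 1"
proof -
  have "(\<Sum>i<n. 1 - sgn (x - v i)) = (\<Sum>y\<in>v ` {..<n}. 1 - sgn (x - y))"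
    using assms(1) by (simp add: sum.reindex)
  also have "\<dots> = (\<Sum>y\<in>v ` {..<n} \<inter> {x..t}. 1 - sgn (x - y))"
    using assms(2) by (intro sum.mono_neutral_right) (auto simp: sgn_if split: if_splits)
  also have "\<dots> \<le> (\<Sum>y\<in>{x..t}. 1 - sgn (x - y))"
    by (intro sum_mono2) (auto simp: sgn_if)
  also have "{x..t} = insert x {x+1..t}"
    using assms(3) by auto
  also have "(\<Sum>y\<in>insert x {x+1..t}. 1 - sgn (x - y)) = 1 + (\<Sum>y\<in>{x+1..t}. 1 - sgn (x - y))"
    by simp
  also have "(\<Sum>y\<in>{x+1..t}. 1 - sgn (x - y)) = (\<Sum>y\<in>{x+1..t}. 2)"
    by (rule sum.cong) auto
  also have "1 + \<dots> = 2 * (t - x) + 1"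
    using assms(3) by simp
  finally show ?thesis .
qed

text \<open>
  Twice the maximum is \<open>x + y + \<bar>x - y\<bar>\<close>, and the sign is a subgradient of the convex function
  \<open>\<bar>_\<bar>\<close> at \<open>x' - y'\<close>. Treating ties evenly is essential: counting a tie for one of the two
  entries only gives a bound that is too weak by one to be strict in the next lemma.
\<close>

lemma max_decrease:
  fixes x y x' y' :: int
  assumes "x' \<le> x" "y' \<le> y"
  shows "(1 + sgn (x' - y')) * (x - x') + (1 - sgn (x' - y')) * (y - y') \<le> 2 * max x y - 2 * max x' y'"
  using assms by (auto simp: sgn_if max_def)

text \<open>
  The order is the sum of the maxima over all pairs of entries minus the sum of \<open>x (x + 1)\<close> over the
  entries. Here \<open>T\<close> is the top entry of one row, \<open>a\<close> lists the rest of this row and \<open>b\<close> the other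
  row. Taking \<open>k\<close> units from \<open>a\<close> and \<open>b\<close> and putting them on \<open>T\<close> affects the quadratic term most at
  the largest entry. The loss there has to be weighed against the number of pairs in which an entry
  is the maximum, which is larger for larger entries; but a value occurs at most once in each row, so
  among all entries at most \<open>2 (T - x)\<close> or so exceed \<open>x\<close>, and the quadratic term wins.

  Precisely, all orders being doubled: every unit by which a lower entry exceeds its new value
  accounts for at least \<open>K\<close> in the old order, \<open>K k\<close> in total, whereas raising \<open>T\<close> by \<open>k\<close> adds only
  \<open>K k - k (2 k - 1)\<close>.
\<close>

lemma raising_top_entry_lowers_order:
  fixes a a' b b' :: "nat \<Rightarrow> int" and T k :: int
  assumes a: "\<And>i. i < M \<Longrightarrow> a i \<le> T - 1 - int i" and b: "\<And>j. j < N \<Longrightarrow> b j \<le> T - int j"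
    and inj: "inj_on a' {..<M}" "inj_on b' {..<N}"
    and le: "\<And>i. i < M \<Longrightarrow> a' i \<le> a i" "\<And>j. j < N \<Longrightarrow> b' j \<le> b j"
    and k: "k = (\<Sum>i<M. a i - a' i) + (\<Sum>j<N. b j - b' j)" "0 < k"
  shows "(int M + int N) * (T + k) - (T + k) * (T + k + 1)
      + (\<Sum>i<M. entry_ord M i (a' i)) + (\<Sum>j<N. entry_ord N j (b' j)) + (\<Sum>i<M. \<Sum>j<N. max (a' i) (b' j))
    < (int M + int N) * T - T * (T + 1)
      + (\<Sum>i<M. entry_ord M i (a i)) + (\<Sum>j<N. entry_ord N j (b j)) + (\<Sum>i<M. \<Sum>j<N. max (a i) (b j))"
proof -
  define K where "K = 2 * (int M + int N) - 4 * T - 3"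
  define s where "s i j = sgn (a' i - b' j)" for i j
  have row_a: "K * (a i - a' i) \<le> 2 * entry_ord M i (a i) - 2 * entry_ord M i (a' i)
      + (a i - a' i) * (\<Sum>j<N. 1 + s i j)" if i: "i < M" for i
  proof -
    have "(\<Sum>j<N. 1 - s i j) \<le> 2 * (T - a' i) + 1"
      unfolding s_def
    proof (rule sum_one_minus_sgn[OF inj(2)])
      show "b' j \<le> T" if "j < N" for j using b[OF that] le(2)[OF that] by simp
      show "a' i \<le> T" using a[OF i] le(1)[OF i] by simp
    qed
    moreover have "(\<Sum>j<N. 1 + s i j) = 2 * int N - (\<Sum>j<N. 1 - s i j)"
      by (simp add: sum.distrib sum_subtractf)
    ultimately have "K \<le> 2 * (int M - 1 - int i) - 2 * (a i + a' i) - 2 + (\<Sum>j<N. 1 + s i j)"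
      using a[OF i] unfolding K_def by presburger
    then have "K * (a i - a' i)
        \<le> (2 * (int M - 1 - int i) - 2 * (a i + a' i) - 2 + (\<Sum>j<N. 1 + s i j)) * (a i - a' i)"
      using le(1)[OF i] by (intro mult_right_mono) auto
    also have "\<dots> = 2 * entry_ord M i (a i) - 2 * entry_ord M i (a' i)
        + (a i - a' i) * (\<Sum>j<N. 1 + s i j)"
      unfolding entry_ord_def by algebra
    finally show ?thesis .
  qed
  have row_b: "K * (b j - b' j) \<le> 2 * entry_ord N j (b j) - 2 * entry_ord N j (b' j)
      + (b j - b' j) * (\<Sum>i<M. 1 - s i j)" if j: "j < N" for j
  proof (cases "b' j = b j")
    \<comment> \<open>Only a decreased entry is known to be below \<open>T\<close>, as the count below requires:
      \<open>b j = T\<close> is possible for \<open>j = 0\<close>.\<close>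
    case False
    have "sgn (a' i - b' j) = - sgn (b' j - a' i)" for i
      by (simp add: sgn_if)
    then have "(\<Sum>i<M. 1 + s i j) = (\<Sum>i<M. 1 - sgn (b' j - a' i))"
      by (simp add: s_def)
    also have "\<dots> \<le> 2 * (T - 1 - b' j) + 1"
    proof (rule sum_one_minus_sgn[OF inj(1)])
      show "a' i \<le> T - 1" if "i < M" for i using a[OF that] le(1)[OF that] by simp
      show "b' j \<le> T - 1" using b[OF j] le(2)[OF j] False by simp
    qed
    moreover have "(\<Sum>i<M. 1 - s i j) = 2 * int M - (\<Sum>i<M. 1 + s i j)"
      by (simp add: sum.distrib sum_subtractf)
    ultimately have "K \<le> 2 * (int N - 1 - int j) - 2 * (b j + b' j) - 2 + (\<Sum>i<M. 1 - s i j)"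
      using b[OF j] unfolding K_def by presburger
    then have "K * (b j - b' j)
        \<le> (2 * (int N - 1 - int j) - 2 * (b j + b' j) - 2 + (\<Sum>i<M. 1 - s i j)) * (b j - b' j)"
      using le(2)[OF j] by (intro mult_right_mono) auto
    also have "\<dots> = 2 * entry_ord N j (b j) - 2 * entry_ord N j (b' j)
        + (b j - b' j) * (\<Sum>i<M. 1 - s i j)"
      unfolding entry_ord_def by algebra
    finally show ?thesis .
  qed simp
  have "(\<Sum>i<M. \<Sum>j<N. (1 + s i j) * (a i - a' i) + (1 - s i j) * (b j - b' j))
      \<le> (\<Sum>i<M. \<Sum>j<N. 2 * max (a i) (b j) - 2 * max (a' i) (b' j))"
    unfolding s_def using le by (intro sum_mono max_decrease) auto
  moreover have "(\<Sum>i<M. \<Sum>j<N. (1 + s i j) * (a i - a' i) + (1 - s i j) * (b j - b' j))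
      = (\<Sum>i<M. (a i - a' i) * (\<Sum>j<N. 1 + s i j)) + (\<Sum>j<N. (b j - b' j) * (\<Sum>i<M. 1 - s i j))"
  proof -
    have "(\<Sum>i<M. \<Sum>j<N. (1 - s i j) * (b j - b' j)) = (\<Sum>j<N. \<Sum>i<M. (1 - s i j) * (b j - b' j))"
      by (rule sum.swap)
    then show ?thesis
      unfolding sum.distrib[of "\<lambda>j. (1 + s _ j) * (a _ - a' _)"] sum.distrib[where h = "\<lambda>i. \<Sum>j<N. (1 - s i j) * (b j - b' j)"]
      by (simp only: sum_distrib_left mult.commute)
  qed
  moreover have "(\<Sum>i<M. \<Sum>j<N. 2 * max (a i) (b j) - 2 * max (a' i) (b' j))
      = 2 * (\<Sum>i<M. \<Sum>j<N. max (a i) (b j)) - 2 * (\<Sum>i<M. \<Sum>j<N. max (a' i) (b' j))"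
    by (simp only: sum_subtractf sum_distrib_left)
  moreover have "K * k \<le> (\<Sum>i<M. 2 * entry_ord M i (a i) - 2 * entry_ord M i (a' i)
        + (a i - a' i) * (\<Sum>j<N. 1 + s i j))
      + (\<Sum>j<N. 2 * entry_ord N j (b j) - 2 * entry_ord N j (b' j)
        + (b j - b' j) * (\<Sum>i<M. 1 - s i j))"
    unfolding k(1) distrib_left[of K] sum_distrib_left[of K] using row_a row_b
    by (intro add_mono sum_mono) (simp_all only: lessThan_iff)
  moreover have "(\<Sum>i<M. 2 * entry_ord M i (a i) - 2 * entry_ord M i (a' i)
        + (a i - a' i) * (\<Sum>j<N. 1 + s i j))
      = 2 * (\<Sum>i<M. entry_ord M i (a i)) - 2 * (\<Sum>i<M. entry_ord M i (a' i))
        + (\<Sum>i<M. (a i - a' i) * (\<Sum>j<N. 1 + s i j))"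
    by (simp only: sum.distrib sum_subtractf sum_distrib_left)
  moreover have "(\<Sum>j<N. 2 * entry_ord N j (b j) - 2 * entry_ord N j (b' j)
        + (b j - b' j) * (\<Sum>i<M. 1 - s i j))
      = 2 * (\<Sum>j<N. entry_ord N j (b j)) - 2 * (\<Sum>j<N. entry_ord N j (b' j))
        + (\<Sum>j<N. (b j - b' j) * (\<Sum>i<M. 1 - s i j))"
    by (simp only: sum.distrib sum_subtractf sum_distrib_left)
  moreover have "2 * ((int M + int N) * (T + k) - (T + k) * (T + k + 1))
      < K * k + 2 * ((int M + int N) * T - T * (T + 1))"
  proof -
    have "K * k + 2 * ((int M + int N) * T - T * (T + 1))
      - 2 * ((int M + int N) * (T + k) - (T + k) * (T + k + 1)) = k * (2 * k - 1)"
      unfolding K_def by algebra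
    moreover have "0 < k * (2 * k - 1)" using k(2) by simp
    ultimately show ?thesis by linarith
  qed
  ultimately have "2 * ((int M + int N) * (T + k) - (T + k) * (T + k + 1))
      + 2 * (\<Sum>i<M. entry_ord M i (a' i)) + 2 * (\<Sum>j<N. entry_ord N j (b' j))
      + 2 * (\<Sum>i<M. \<Sum>j<N. max (a' i) (b' j))
    < 2 * ((int M + int N) * T - T * (T + 1))
      + 2 * (\<Sum>i<M. entry_ord M i (a i)) + 2 * (\<Sum>j<N. entry_ord N j (b j))
      + 2 * (\<Sum>i<M. \<Sum>j<N. max (a i) (b j))"
    by linarith
  then have "2 * ((int M + int N) * (T + k) - (T + k) * (T + k + 1)
      + (\<Sum>i<M. entry_ord M i (a' i)) + (\<Sum>j<N. entry_ord N j (b' j)) + (\<Sum>i<M. \<Sum>j<N. max (a' i) (b' j)))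
    < 2 * ((int M + int N) * T - T * (T + 1)
      + (\<Sum>i<M. entry_ord M i (a i)) + (\<Sum>j<N. entry_ord N j (b j)) + (\<Sum>i<M. \<Sum>j<N. max (a i) (b j)))"
    by (simp only: distrib_left[of "2::int"])
  then show ?thesis by (simp only: mult_less_cancel_left_pos zero_less_numeral)
qed

text \<open>
  In terms of bi-partitions: interlacing allows an element of \<open>Theta G G' L\<close> to differ from
  \<open>(m + one_row t, l)\<close> only by boxes moved into the first row. The bound on \<open>nth_part l 0 + m2\<close> says
  that the first entry of the first row is at least the first entry of the second.
\<close>

lemma pair_ord_less:
  assumes nonzero: "0 \<notin># l" "0 \<notin># m" "0 \<notin># l'" "0 \<notin># m'"
    and size: "size m < m1" "size l' \<le> m1" "size l \<le> m2" "size m' \<le> m2"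
    and inter: "interlaces l' m" "interlaces l m'"
    and sum: "sum_mset l' + sum_mset m' = t + sum_mset l + sum_mset m"
    and t: "\<forall>x\<in>#m. x \<le> t" "nth_part l 0 + m2 \<le> t + m1"
    and neq: "(l', m') \<noteq> (m + one_row t, l)"
  shows "pair_ord m1 l' m2 m' < pair_ord m1 (m + one_row t) m2 l"
proof -
  obtain M where m1: "m1 = Suc M" using size(1) by (cases m1) auto
  note row = nth_part_add_row[OF t(1)]
  define p where "p = m + one_row t"
  define T k where "T = int (t + M)" and "k = int (nth_part l' 0) - int t"
  define a a' where "a i = int (entry m1 p (Suc i))" and "a' i = int (entry m1 l' (Suc i))" for i
  define b b' where "b j = int (entry m2 l j)" and "b' j = int (entry m2 m' j)" for j
  have diff_a: "a i - a' i = int (nth_part m i) - int (nth_part l' (Suc i))" for i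
    by (simp add: a_def a'_def entry_def p_def row)
  have diff_b: "b j - b' j = int (nth_part l j) - int (nth_part m' j)" for j
    by (simp add: b_def b'_def entry_def)
  have le: "a' i \<le> a i" "b' i \<le> b i" for i
    using inter diff_a[of i] diff_b[of i] by (auto simp: interlaces_def dest!: spec[of _ i])
  have k: "k = (\<Sum>i<M. a i - a' i) + (\<Sum>j<m2. b j - b' j)"
  proof -
    have "(\<Sum>i<M. nth_part m i) = sum_mset m" "(\<Sum>j<m2. nth_part l j) = sum_mset l"
      "(\<Sum>j<m2. nth_part m' j) = sum_mset m'"
      using nonzero size m1 by (auto intro: sum_nth_part)
    moreover have "nth_part l' 0 + (\<Sum>i<M. nth_part l' (Suc i)) = sum_mset l'"
      using sum_nth_part[of l' m1] nonzero size by (simp add: m1 sum.lessThan_Suc_shift del: sum.lessThan_Suc)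
    ultimately have "int (nth_part l' 0) + int (\<Sum>i<M. nth_part l' (Suc i)) + int (\<Sum>j<m2. nth_part m' j)
        = int t + int (\<Sum>j<m2. nth_part l j) + int (\<Sum>i<M. nth_part m i)"
      using sum by linarith
    then show ?thesis
      by (simp add: k_def diff_a diff_b sum_subtractf)
  qed
  have "k \<noteq> 0"
  proof
    assume "k = 0"
    have nonneg: "0 \<le> (\<Sum>i<M. a i - a' i)" "0 \<le> (\<Sum>j<m2. b j - b' j)"
      using le by (auto intro: sum_nonneg)
    with k \<open>k = 0\<close> have "(\<Sum>i<M. a i - a' i) = 0" "(\<Sum>j<m2. b j - b' j) = 0"
      by linarith+
    then have "\<forall>i<M. a i - a' i = 0" "\<forall>j<m2. b j - b' j = 0"
      using le by (simp_all add: sum_nonneg_eq_0_iff)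
    then have in_range: "i < M \<Longrightarrow> nth_part l' (Suc i) = nth_part m i"
      "j < m2 \<Longrightarrow> nth_part m' j = nth_part l j" for i j
      using diff_a diff_b by simp_all
    have "nth_part l' (Suc i) = nth_part m i" for i
      using in_range(1)[of i] size m1 by (cases "i < M") (simp_all add: nth_part_beyond)
    moreover have "nth_part l' 0 = t"
      using \<open>k = 0\<close> by (simp add: k_def)
    ultimately have "nth_part l' i = nth_part p i" for i
      by (cases i) (simp_all add: p_def row)
    moreover have "nth_part m' j = nth_part l j" for j
      using in_range(2)[of j] size by (cases "j < m2") (simp_all add: nth_part_beyond)
    moreover have "0 \<notin># p"
      using nonzero by (auto simp: p_def one_row_def)
    ultimately show False
      using neq nonzero by (auto simp: p_def intro: partition_eqI)
  qed
  moreover have "0 \<le> k"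
    unfolding k using le by (auto intro!: add_nonneg_nonneg sum_nonneg)
  ultimately have "0 < k" by simp
  have top: "int (entry m1 p 0) = T" "int (entry m1 l' 0) = T + k"
    by (simp_all add: entry_def m1 p_def row T_def k_def)
  have b_le: "b j \<le> T - int j" if "j < m2" for j
    using that t(2) nth_part_antimono[of 0 j l] by (simp add: b_def entry_def T_def m1)
  have less: "(int M + int m2) * (T + k) - (T + k) * (T + k + 1)
      + (\<Sum>i<M. entry_ord M i (a' i)) + (\<Sum>j<m2. entry_ord m2 j (b' j)) + (\<Sum>i<M. \<Sum>j<m2. max (a' i) (b' j))
    < (int M + int m2) * T - T * (T + 1)
      + (\<Sum>i<M. entry_ord M i (a i)) + (\<Sum>j<m2. entry_ord m2 j (b j)) + (\<Sum>i<M. \<Sum>j<m2. max (a i) (b j))"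
  proof (rule raising_top_entry_lowers_order[OF _ b_le _ _ le k \<open>0 < k\<close>])
    show "a i \<le> T - 1 - int i" if "i < M" for i
      using that t(1) nth_part_member[of m i]
      by (auto simp: a_def entry_def T_def m1 p_def row)
    show "inj_on a' {..<M}"
      using inj_on_entry[of m1 l'] by (auto simp: inj_on_def a'_def m1)
    show "inj_on b' {..<m2}"
      using inj_on_entry[of m2 m'] by (auto simp: inj_on_def b'_def)
  qed
  \<comment> \<open>Splitting off the first entry \<open>x\<close> of the first row, which is the maximum of every pair that
    contains it.\<close>
  have split: "pair_ord m1 r m2 q = (int M + int m2) * x - x * (x + 1)
      + (\<Sum>i<M. entry_ord M i (int (entry m1 r (Suc i)))) + (\<Sum>j<m2. entry_ord m2 j (int (entry m2 q j)))
      + (\<Sum>i<M. \<Sum>j<m2. max (int (entry m1 r (Suc i))) (int (entry m2 q j)))"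
    if "int (entry m1 r 0) = x" and "\<And>j. j < m2 \<Longrightarrow> int (entry m2 q j) \<le> x" for r q x
  proof -
    have "(\<Sum>j<m2. max (int (entry m1 r 0)) (int (entry m2 q j))) = int m2 * x"
      using that by (simp add: max_absorb1)
    moreover have "entry_ord m1 (Suc i) y = entry_ord M i y" for i y
      by (simp add: entry_ord_def m1)
    moreover have "entry_ord m1 0 x = int M * x - x * (x + 1)"
      by (simp add: entry_ord_def m1)
    ultimately show ?thesis
      using that(1) unfolding pair_ord_def
      by (simp add: m1 sum.lessThan_Suc_shift algebra_simps del: sum.lessThan_Suc)
  qed
  have "b j \<le> T" "b' j \<le> T + k" if "j < m2" for j
    using b_le[OF that] le(2)[of j] \<open>0 < k\<close> by simp_all
  then show ?thesis
    using less split[OF top(1), of l] split[OF top(2), of m']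
    by (simp add: a_def a'_def b_def b'_def p_def)
qed

section \<open>The stable range\<close>

text \<open>
  Write the defect as \<open>4 d + r\<close>. By the rank formula, the half dimension \<open>n\<close> of \<open>G\<close> is
  \<open>|p| + |q|\<close> plus a quadratic polynomial in \<open>d\<close> with leading term \<open>4 d\<^sup>2\<close>, and \<open>\<tau>\<close> is at least \<open>n\<close> up
  to terms linear in \<open>d\<close>. What remains of each inequality is that a quadratic polynomial
  in \<open>d\<close> is non-negative at all integers. The third bound compares the added row with the rows of the
  other partition after the shift by the defect \<open>D\<close>.
\<close>

lemma stable_range_bounds:
  assumes "stable_range G G'" and "L \<in> symbols_of G" and "Upsilon L = (p, q)"
    and e: "e = pair_sign G G'"
    and D: "D = target_defect e (defect L)"
    and \<tau>: "\<tau> = theta_tau e (half_dim G) (half_dim G') (defect L)"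
  shows "int (sum_mset p) + int (sum_mset q) \<le> \<tau>"
    and "int (sum_mset p) + int (sum_mset q) + \<tau> + D\<^sup>2 div 4 = int (half_dim G')"
    and "int (sum_mset p) + int (sum_mset q) \<le> (case e of Plus \<Rightarrow> \<tau> + D | Minus \<Rightarrow> \<tau> - D)"
    and "rk L = int (half_dim G)"
proof -
  define P d where "P = int (sum_mset p) + int (sum_mset q)" and "d = defect L div 4"
  have rk: "rk L = P + (defect L)\<^sup>2 div 4"
    unfolding P_def by (rule rk_eq) fact
  have mod: "defect L = 4 * d + r" if "defect L mod 4 = r" for r
    using that unfolding d_def by presburger
  have sq: "(4 * d)\<^sup>2 div 4 = 4 * (d * d)" "(4 * d + 1)\<^sup>2 div 4 = 4 * (d * d) + 2 * d"
    "(4 * d + 2)\<^sup>2 div 4 = 4 * (d * d) + 4 * d + 1"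
    "(1 - 4 * d)\<^sup>2 div 4 = 4 * (d * d) - 2 * d" "(- 2 - 4 * d)\<^sup>2 div 4 = 4 * (d * d) + 4 * d + 1"
    "(- 3 - 4 * d)\<^sup>2 div 4 = 4 * (d * d) + 6 * d + 2"
    using even_square_div_4[of "2 * d"] odd_square_div_4[of "2 * d"] even_square_div_4[of "2 * d + 1"]
      odd_square_div_4[of "- 2 * d"] even_square_div_4[of "- 1 - 2 * d"] odd_square_div_4[of "- 2 * d - 2"]
    by (simp_all add: algebra_simps)
  have dd: "d \<le> d * d" "- d \<le> d * d" "0 \<le> d * d" 
    and dd': "0 \<le> 4 * (d * d) + 2 * d" "0 \<le> 4 * (d * d) + 6 * d + 3"
  proof -
    have "0 \<le> d * (d - 1)" "0 \<le> d * (d + 1)" by (auto simp: zero_le_mult_iff)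
    then show "d \<le> d * d" and minus: "- d \<le> d * d" by (simp_all add: algebra_simps)
    show "0 \<le> d * d" by simp
    then show "0 \<le> 4 * (d * d) + 2 * d" using minus by linarith
    have "4 * (d * d) + 6 * d + 3 = 3 * ((d + 1) * (d + 1)) + d * d" by (simp add: algebra_simps)
    then show "0 \<le> 4 * (d * d) + 6 * d + 3"
      by (simp only: add_nonneg_nonneg mult_nonneg_nonneg zero_le_square zero_le_numeral)
  qed
  have "P \<le> \<tau> \<and> P + \<tau> + D\<^sup>2 div 4 = int (half_dim G')
      \<and> P \<le> (case e of Plus \<Rightarrow> \<tau> + D | Minus \<Rightarrow> \<tau> - D) \<and> rk L = int (half_dim G)"
  proof (cases G)
    case (Sp n)
    then have "defect L mod 4 = 1" using assms(2) by simp
    then have \<delta>: "defect L = 4 * d + 1" by (rule mod)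
    have n: "int n = P + 4 * (d * d) + 2 * d"
      using assms(2) rk sq(2) by (simp add: Sp \<delta>)
    show ?thesis
    proof (cases "(G, G')" rule: stable_range.cases)
      case (2 k n')
      then show ?thesis using Sp \<delta> n assms(1) dd sq by (simp add: e D \<tau> rk d_def[symmetric])
    next
      case (3 k n')
      then show ?thesis using Sp \<delta> n assms(1) dd sq by (simp add: e D \<tau> rk d_def[symmetric])
    qed (use assms(1) Sp in auto)
  next
    case (Orth s n)
    then obtain n' where G': "G' = Sp n'" "2 * n \<le> n'"
      using assms(1) by (cases G') auto
    show ?thesis
    proof (cases s)
      case Plus
      then have "defect L mod 4 = 0" using assms(2) Orth by simp
      then have \<delta>: "defect L = 4 * d" using mod[of 0] by simp
      have "int n = P + 4 * (d * d)"
        using assms(2) rk sq(1) by (simp add: Plus Orth \<delta>)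
      with \<delta> show ?thesis using Plus Orth G' dd sq by (simp add: e D \<tau> rk d_def[symmetric])
    next
      case Minus
      then have "defect L mod 4 = 2" using assms(2) Orth by simp
      then have \<delta>: "defect L = 4 * d + 2" by (rule mod)
      have "int n = P + 4 * (d * d) + 4 * d + 1"
        using assms(2) rk sq(3) by (simp add: Minus Orth \<delta>)
      with \<delta> show ?thesis using Minus Orth G' dd' sq by (simp add: e D \<tau> rk d_def[symmetric])
    qed
  qed
  then show "int (sum_mset p) + int (sum_mset q) \<le> \<tau>"
    and "int (sum_mset p) + int (sum_mset q) + \<tau> + D\<^sup>2 div 4 = int (half_dim G')"
    and "int (sum_mset p) + int (sum_mset q) \<le> (case e of Plus \<Rightarrow> \<tau> + D | Minus \<Rightarrow> \<tau> - D)"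
    and "rk L = int (half_dim G)"
    unfolding P_def by blast+
qed

lemma interlaces_refl: "interlaces p p"
  by (simp add: interlaces_def nth_part_antimono)

lemma interlaces_add_row:
  assumes "\<forall>x\<in>#p. x \<le> t"
  shows "interlaces (p + one_row t) p"
  unfolding interlaces_def
proof
  fix i
  have "nth_part p i \<le> nth_part (p + one_row t) i"
  proof (cases i)
    case 0
    then show ?thesis
      using nth_part_member[of p 0] assms nth_part_add_row(1)[OF assms] by auto
  next
    case (Suc j)
    then show ?thesis
      by (simp add: nth_part_add_row(2)[OF assms] nth_part_antimono)
  qed
  then show "nth_part (p + one_row t) (Suc i) \<le> nth_part p i \<and> nth_part p i \<le> nth_part (p + one_row t) i"
    by (simp add: nth_part_add_row(2)[OF assms])
qed

context
  fixes G G' :: classical_group and e :: sign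
  assumes stable: "stable_range G G'" and e: "e = pair_sign G G'"
begin

text \<open>
  The symbol described in the definition of \<open>theta_lower\<close> exists because its rank comes out as the
  half dimension of \<open>G'\<close>, and it is unique because defect and bi-partition determine a symbol.
\<close>

lemma theta_lower_spec:
  assumes L: "L \<in> symbols_of G" and U: "Upsilon L = (p, q)"
  shows "theta_lower G G' L \<in> symbols (half_dim G') (target_defect e (defect L))"
    and "Upsilon (theta_lower G G' L) =
      add_row e (nat (theta_tau e (half_dim G) (half_dim G') (defect L))) (p, q)"
proof -
  define t where "t = nat (theta_tau e (half_dim G) (half_dim G') (defect L))"
  define D where "D = target_defect e (defect L)"
  note bounds = stable_range_bounds[OF stable L U e D_def refl]
  obtain p' q' where row: "add_row e t (p, q) = (p', q')" by fastforce
  have nonzero: "0 \<notin># p'" "0 \<notin># q'"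
    using row symbol_eq_symbol_of(1,2)[OF U] by (cases e; auto simp: one_row_def split: if_splits)+
  have size: "sum_mset p' + sum_mset q' = sum_mset p + sum_mset q + t"
    using row by (cases e) (auto simp: one_row_def)
  obtain L0 where L0: "Upsilon L0 = (p', q')" "defect L0 = D"
    using nonzero by (rule symbol_exists)
  have "rk L0 = int (sum_mset p' + sum_mset q') + D\<^sup>2 div 4"
    using rk_eq[OF L0(1)] L0(2) by simp
  then have "rk L0 = int (half_dim G')"
    using bounds(1,2) by (simp add: size t_def)
  then have "L0 \<in> symbols (half_dim G') D \<and> Upsilon L0 = add_row e t (p, q)"
    using L0 row by (simp add: symbols_def)
  moreover have "L1 = L0" if "L1 \<in> symbols (half_dim G') D \<and> Upsilon L1 = add_row e t (p, q)" for L1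
    using that L0 row by (intro symbol_eqI) (auto simp: symbols_def)
  ultimately have "theta_lower G G' L = L0"
    unfolding theta_lower_def U e[symmetric] t_def[symmetric] D_def[symmetric]
    by (intro the_equality)
  then show "theta_lower G G' L \<in> symbols (half_dim G') (target_defect e (defect L))"
    and "Upsilon (theta_lower G G' L) =
      add_row e (nat (theta_tau e (half_dim G) (half_dim G') (defect L))) (p, q)"
    using \<open>L0 \<in> _ \<and> _\<close> by (simp_all add: t_def D_def)
qed

lemma theta_lower_in_Theta:
  assumes L: "L \<in> symbols_of G"
  shows "theta_lower G G' L \<in> Theta G G' L"
proof -
  obtain p q where U: "Upsilon L = (p, q)" by fastforce
  define t where "t = nat (theta_tau e (half_dim G) (half_dim G') (defect L))"
  have "sum_mset p + sum_mset q \<le> t"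
    using stable_range_bounds(1)[OF stable L U e refl refl]
    unfolding t_def by linarith
  then have "\<forall>x\<in>#p. x \<le> t" "\<forall>x\<in>#q. x \<le> t"
    using member_le_sum[of _ p] member_le_sum[of _ q] by fastforce+
  then have "theta_related e (p, q) (add_row e t (p, q))"
    by (cases e) (simp_all add: interlaces_refl interlaces_add_row)
  then show ?thesis
    using theta_lower_spec[OF L U] by (simp add: Theta_def U t_def e)
qed

lemma theta_lower_inj:
  assumes "L1 \<in> symbols_of G" "L2 \<in> symbols_of G" "defect L1 = defect L2"
    and "theta_lower G G' L1 = theta_lower G G' L2"
  shows "L1 = L2"
proof -
  obtain p q p' q' where U: "Upsilon L1 = (p, q)" "Upsilon L2 = (p', q')" by fastforce
  have "(p, q) = (p', q')"
    using theta_lower_spec(2)[OF assms(1) U(1)] theta_lower_spec(2)[OF assms(2) U(2)] assms(3,4)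
    by (cases e) auto
  then show ?thesis
    using U assms(3) by (intro symbol_eqI) auto
qed

text \<open>
  Both symbols are represented with the same row lengths, long enough for all four partitions and
  the added row; then their orders differ as \<open>pair_ord\<close> does. For \<open>Minus\<close> the added row sits in the
  second component, and the symmetry of \<open>pair_ord\<close> reduces to the same comparison.
\<close>

lemma theta_lower_strictly_maximal:
  assumes L: "L \<in> symbols_of G" and L': "L' \<in> Theta G G' L" and neq: "L' \<noteq> theta_lower G G' L"
  shows "symbol_ord G' L' < symbol_ord G' (theta_lower G G' L)"
proof -
  define t where "t = nat (theta_tau e (half_dim G) (half_dim G') (defect L))"
  define D where "D = target_defect e (defect L)"
  define L0 where "L0 = theta_lower G G' L"
  obtain p q where U: "Upsilon L = (p, q)" by fastforce
  obtain p' q' where U': "Upsilon L' = (p', q')" by fastforce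
  note bounds = stable_range_bounds[OF stable L U e D_def refl]
  have t: "int t = theta_tau e (half_dim G) (half_dim G') (defect L)"
    using bounds(1) unfolding t_def by linarith
  have L0: "Upsilon L0 = add_row e t (p, q)" "defect L0 = D"
    using theta_lower_spec[OF L U] by (auto simp: L0_def t_def D_def symbols_def)
  have D': "defect L' = D" and rel: "theta_related e (p, q) (p', q')" and rk': "rk L' = int (half_dim G')"
    using L' by (auto simp: Theta_def U U' D_def e symbols_def)
  have neq: "(p', q') \<noteq> add_row e t (p, q)"
    using neq L0 D' U' symbol_eqI[of L' L0] by (auto simp: L0_def)
  have nonzero: "0 \<notin># p" "0 \<notin># q" "0 \<notin># p'" "0 \<notin># q'"
    using symbol_eq_symbol_of(1,2)[OF U] symbol_eq_symbol_of(1,2)[OF U'] by auto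
  have "int (sum_mset p') + int (sum_mset q') + D\<^sup>2 div 4 = int (half_dim G')"
    using rk_eq[OF U'] rk' D' by simp
  then have sum: "sum_mset p' + sum_mset q' = t + sum_mset p + sum_mset q"
    using bounds(2) t by linarith
  have le: "sum_mset p + sum_mset q \<le> t"
    using bounds(1) t by linarith
  then have le_t: "\<forall>x\<in>#p. x \<le> t" "\<forall>x\<in>#q. x \<le> t"
    using member_le_sum[of _ p] member_le_sum[of _ q] by fastforce+
  obtain m1 m2 where m: "int m1 - int m2 = D"
      "Suc (size p + size q + size p' + size q') \<le> m1" "Suc (size p + size q + size p' + size q') \<le> m2"
    by (rule row_lengths_exist)
  have rep': "L' = symbol_of m1 m2 p' q'"
    using m D' by (intro symbol_eq_symbol_of(3)[OF U']) auto
  have size_row: "size (r + one_row t) \<le> Suc (size r)" for r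
    by (simp add: one_row_def)
  have "pair_ord m1 p' m2 q' < pair_ord m1 (fst (Upsilon L0)) m2 (snd (Upsilon L0)) \<and>
    L0 = symbol_of m1 m2 (fst (Upsilon L0)) (snd (Upsilon L0))"
  proof (cases e)
    case Plus
    then have U0: "Upsilon L0 = (q + one_row t, p)" using L0 by simp
    have "L0 = symbol_of m1 m2 (q + one_row t) p"
      using m L0(2) size_row[of q] by (intro symbol_eq_symbol_of(3)[OF U0]) auto
    moreover have "pair_ord m1 p' m2 q' < pair_ord m1 (q + one_row t) m2 p"
    proof (rule pair_ord_less)
      show "nth_part p 0 + m2 \<le> t + m1"
      proof -
        have "int (sum_mset p) + int (sum_mset q) \<le> int t + D"
          using bounds(3) t Plus by (simp only: sign.case)
        then show ?thesis
          using m(1) part_le_sum[of p 0] by linarith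
      qed
    qed (use nonzero m rel sum le_t neq Plus in auto)
    ultimately show ?thesis using U0 by simp
  next
    case Minus
    then have U0: "Upsilon L0 = (q, p + one_row t)" using L0 by simp
    have "L0 = symbol_of m1 m2 q (p + one_row t)"
      using m L0(2) size_row[of p] by (intro symbol_eq_symbol_of(3)[OF U0]) auto
    moreover have "pair_ord m2 q' m1 p' < pair_ord m2 (p + one_row t) m1 q"
    proof (rule pair_ord_less)
      show "nth_part q 0 + m1 \<le> t + m2"
      proof -
        have "int (sum_mset p) + int (sum_mset q) \<le> int t - D"
          using bounds(3) t Minus by (simp only: sign.case)
        then show ?thesis
          using m(1) part_le_sum[of q 0] by linarith
      qed
    qed (use nonzero m rel sum le_t neq Minus in auto)
    ultimately show ?thesis using U0 by (simp add: pair_ord_commute)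
  qed
  then show ?thesis
    unfolding L0_def[symmetric] by (metis rep' symbol_ord_symbol_of add_strict_left_mono)
qed

end

lemma symbol_less_irrefl: "\<not> symbol_less e L L"
  by (cases e; cases "Upsilon L") (auto simp: symbol_less_def lex_less_def)

lemma smallest_singleton: "smallest e {L} = L"
  by (auto simp: smallest_def)

theorem proposition5p6:
  fixes G G' :: classical_group and \<Lambda> :: symbol
  assumes "stable_range G G'"
    and "\<Lambda> \<in> symbols_of G"
  shows "theta_lower G G' \<Lambda> = theta_upper G G' \<Lambda>"
  using assms
proof (induction G G' \<Lambda> rule: theta_upper.induct)
  case (1 G G' L)
  define S where "S = {L1 \<in> symbols (half_dim G) (defect L). symbol_less (pair_sign G G') L1 L}"
  have "rk L = int (half_dim G)"
    using stable_range_bounds(4)[OF 1(2,3) _ refl refl refl] by (cases "Upsilon L") auto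
  then have S: "L1 \<in> symbols_of G" "defect L1 = defect L" "symbol_less (pair_sign G G') L1 L"
    if "L1 \<in> S" for L1
    using that 1(3) by (cases G rule: symbols_of.cases; auto simp: S_def symbols_def)+
  \<comment> \<open>By induction the removed values are values of \<open>theta_lower\<close>, at symbols other than \<open>L\<close>.\<close>
  have "theta_upper G G' ` S = theta_lower G G' ` S"
    using 1(1)[OF _ 1(2) S(1)] by (intro image_cong) (auto simp: S_def)
  moreover have "theta_lower G G' L \<notin> theta_lower G G' ` S"
  proof
    assume "theta_lower G G' L \<in> theta_lower G G' ` S"
    then obtain L1 where L1: "L1 \<in> S" "theta_lower G G' L1 = theta_lower G G' L"
      by (metis imageE)
    then have "L1 = L"
      using theta_lower_inj[OF 1(2) refl S(1) 1(3) S(2)] by blast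
    then show False
      using S(3)[OF L1(1)] symbol_less_irrefl by simp
  qed
  ultimately have "theta_lower G G' L \<in> Theta G G' L - theta_upper G G' ` S"
    using theta_lower_in_Theta[OF 1(2) refl 1(3)] by simp
  then have "max_ord_elements G' (Theta G G' L - theta_upper G G' ` S) = {theta_lower G G' L}"
    using theta_lower_strictly_maximal[OF 1(2) refl 1(3)]
    unfolding max_ord_elements_def by (force simp: not_le[symmetric] intro: less_imp_le)
  then show ?case
    by (simp add: theta_upper.simps[of G G' L] S_def smallest_singleton)
qed

end
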